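(* For all integers $a,b\geq 1$, the letter frequencies of the biperiodic Fibonacci word $\mathfrak{F}^{(a,b)}$ are $$\operatorname{freq}_1\bigl(\mathfrak{F}^{(a,b)}\bigr)=\frac{b}{\alpha+b},\qquad \operatorname{freq}_0\bigl(\mathfrak{F}^{(a,b)}\bigr)=\frac{\alpha}{\alpha+b},$$ where $\alpha=\alpha(a,b)=\dfrac{ab+\sqrt{a^2b^2+4ab}}{2}$.
   Context: Words are over the alphabet $\{0,1\}$; $|w|$ is the length of a finite word $w$ and $|w|_c$ the number of occurrences of the letter $c$ in $w$. For integers $a,b\geq 1$ let $\mathfrak{F}^{(a,b)}_0=1$, $\mathfrak{F}^{(a,b)}_1=0$, and for $n\geq 2$: $\mathfrak{F}^{(a,b)}_n=(\mathfrak{F}^{(a,b)}_{n-1})^a\,\mathfrak{F}^{(a,b)}_{n-2}$ if $n$ is even, $\mathfrak{F}^{(a,b)}_n=(\mathfrak{F}^{(a,b)}_{n-1})^b\,\mathfrak{F}^{(a,b)}_{n-2}$ if $n$ is odd. The infinite word $\mathfrak{F}^{(a,b)}=\lim_{n\to\infty}\mathfrak{F}^{(a,b)}_n$ is the unique infinite word having every $\mathfrak{F}^{(a,b)}_n$, $n\geq 1$, as a prefix. The frequency of the letter $c\in\{0,1\}$ is $\operatorname{freq}_c(\mathfrak{F}^{(a,b)})=\lim_{n\to\infty}|\mathfrak{F}^{(a,b)}_n|_c/|\mathfrak{F}^{(a,b)}_n|$. *)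

theory Defs
  imports Complex_Main "HOL-Library.Omega_Words_Fun"
begin

definition word_power :: "'a list \<Rightarrow> nat \<Rightarrow> 'a list" where
  "word_power u k = concat (replicate k u)"

fun bfib :: "nat \<Rightarrow> nat \<Rightarrow> nat \<Rightarrow> nat list" where
  "bfib a b 0 = [1]"
| "bfib a b (Suc 0) = [0]"
| "bfib a b (Suc (Suc n)) =
     word_power (bfib a b (Suc n)) (if even (Suc (Suc n)) then a else b) @ bfib a b n"

text \<open>
  The index starts at 1, since the word with index 0 is not a prefix of the later ones.
\<close>

definition is_bfib_limit :: "nat \<Rightarrow> nat \<Rightarrow> nat word \<Rightarrow> bool" where
  "is_bfib_limit a b w \<longleftrightarrow> (\<forall>n\<ge>1. prefix (length (bfib a b n)) w = bfib a b n)"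

definition bfib_word :: "nat \<Rightarrow> nat \<Rightarrow> nat word" where
  "bfib_word a b = (THE w. is_bfib_limit a b w)"

text \<open>
  The frequency of a letter in the infinite word \<open>bfib_word a b\<close> is, by definition, the limit
  along its prefixes \<open>bfib a b n\<close> (they are prefixes by \<open>prefix_bfib_word\<close> below).
  Since \<^const>\<open>lim\<close> is unspecified for divergent sequences, a claim about the value of a
  frequency has to be accompanied by convergence of \<open>bfib_ratio a b c\<close>.
\<close>

definition bfib_ratio :: "nat \<Rightarrow> nat \<Rightarrow> nat \<Rightarrow> nat \<Rightarrow> real" where
  "bfib_ratio a b c n = real (count_list (bfib a b n) c) / real (length (bfib a b n))"

definition bfib_freq :: "nat \<Rightarrow> nat \<Rightarrow> nat \<Rightarrow> real" where
  "bfib_freq a b c = lim (bfib_ratio a b c)"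

definition bfib_alpha :: "nat \<Rightarrow> nat \<Rightarrow> real" where
  "bfib_alpha a b = (real a * real b + sqrt ((real a)\<^sup>2 * (real b)\<^sup>2 + 4 * real a * real b)) / 2"

lemma bfib_Suc_append:
  assumes "a \<ge> 1" "b \<ge> 1" "n \<ge> 1"
  shows "\<exists>v. bfib a b (Suc n) = bfib a b n @ v \<and> v \<noteq> []"
proof -
  have ne: "bfib a b m \<noteq> []" for m
    by (induction a b m rule: bfib.induct) auto
  obtain m where m: "n = Suc m" using assms(3) by (cases n) auto
  obtain k where k: "(if even (Suc (Suc m)) then a else b) = Suc k"
    using assms(1,2) by (cases "if even (Suc (Suc m)) then a else b") (auto split: if_splits)
  have "bfib a b (Suc n) = bfib a b n @ (word_power (bfib a b n) k @ bfib a b m)"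
    unfolding m bfib.simps(3) k by (simp add: word_power_def)
  with ne[of m] show ?thesis by blast
qed

lemma bfib_append:
  assumes "a \<ge> 1" "b \<ge> 1" "n \<ge> 1" "n \<le> m"
  shows "\<exists>v. bfib a b m = bfib a b n @ v"
  using assms(4)
proof (induction m rule: dec_induct)
  case base
  then show ?case by simp
next
  case (step k)
  then show ?case using bfib_Suc_append[of a b k] assms by fastforce
qed

lemma length_bfib_ge:
  assumes "a \<ge> 1" "b \<ge> 1"
  shows "n \<le> length (bfib a b n)"
proof (induction n)
  case (Suc n)
  show ?case
  proof (cases "n = 0")
    case False
    then obtain v where "bfib a b (Suc n) = bfib a b n @ v" "v \<noteq> []"
      using bfib_Suc_append[of a b n] assms by auto
    with Suc show ?thesis by (cases v) auto
  qed simp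
qed simp

lemma ex1_bfib_limit:
  assumes "a \<ge> 1" "b \<ge> 1"
  shows "\<exists>!w. is_bfib_limit a b w"
proof (rule ex1I)
  let ?w = "\<lambda>i. bfib a b (Suc i) ! i"
  have len: "i < length (bfib a b (Suc i))" for i
    using length_bfib_ge[OF assms, of "Suc i"] by simp
  have nth: "bfib a b (Suc i) ! i = bfib a b n ! i" if "n \<ge> 1" "i < length (bfib a b n)" for i n
  proof (cases "n \<le> Suc i")
    case True
    then show ?thesis using bfib_append[OF assms that(1)] that(2) by (metis nth_append_left)
  next
    case False
    then show ?thesis
      using bfib_append[OF assms, of "Suc i" n] len[of i]
      by (metis nth_append_left le_add1 nat_le_linear plus_1_eq_Suc)
  qed
  show "is_bfib_limit a b ?w"
    unfolding is_bfib_limit_def using nth by (auto intro!: nth_equalityI)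
  fix w assume w: "is_bfib_limit a b w"
  show "w = ?w"
  proof
    fix i
    have "prefix (length (bfib a b (Suc i))) w ! i = w i"
      using len[of i] by (simp del: bfib.simps)
    moreover have "prefix (length (bfib a b (Suc i))) w = bfib a b (Suc i)"
      using w unfolding is_bfib_limit_def by simp
    ultimately show "w i = ?w i" by simp
  qed
qed

lemma prefix_bfib_word:
  assumes "a \<ge> 1" "b \<ge> 1" "n \<ge> 1"
  shows "prefix (length (bfib a b n)) (bfib_word a b) = bfib a b n"
  using theI'[OF ex1_bfib_limit[OF assms(1,2)]] assms(3)
  unfolding bfib_word_def is_bfib_limit_def by blast

end

theory Submission imports Defs begin

text \<open>
  Let \<open>x n\<close> and \<open>y n\<close> be the numbers of letters 1 and 0 in the \<open>n\<close>-th word. The claimed limits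
  say that \<open>y n / x n\<close> tends to \<open>\<alpha> / b\<close>, so the quantity to control is the discrepancy
  \<open>b * y n - \<alpha> * x n\<close>. It is linear in the letter counts and hence satisfies the same two-term
  recurrence as they do. The number \<open>\<alpha>\<close> is the positive root of \<open>\<alpha>\<^sup>2 = a * b * (\<alpha> + 1)\<close>, which is
  exactly the relation making the discrepancy a solution without a growing component: over two
  steps of the recurrence it is multiplied by \<open>1 / (1 + \<alpha>) < 1\<close>
  (\<open>discrepancy_closed_form\<close>). It is therefore bounded, while the lengths of the words tend to
  infinity. Dividing by the length gives
  \<open>b * freq\<^sub>0 = \<alpha> * freq\<^sub>1\<close> in the limit, and together with \<open>freq\<^sub>0 + freq\<^sub>1 = 1\<close> this determines
  both frequencies.
\<close>

lemma count_list_word_power: "count_list (word_power u k) c = k * count_list u c"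
  unfolding word_power_def by (induction k) auto

lemma set_bfib: "set (bfib a b n) \<subseteq> {0, 1}"
  by (induction a b n rule: bfib.induct) (auto simp: word_power_def)

lemma length_bfib: "length (bfib a b n) = count_list (bfib a b n) 0 + count_list (bfib a b n) 1"
  using sum_count_set[OF set_bfib, of a b n] by simp

lemma bfib_alpha_pos:
  assumes "a \<ge> 1" and "b \<ge> 1"
  shows "bfib_alpha a b > 0"
  unfolding bfib_alpha_def using assms by (auto intro!: add_pos_nonneg)

lemma bfib_alpha_square: "(bfib_alpha a b)\<^sup>2 = real a * real b * (bfib_alpha a b + 1)"
proof -
  define s where "s = sqrt ((real a)\<^sup>2 * (real b)\<^sup>2 + 4 * real a * real b)"
  have "s\<^sup>2 = (real a)\<^sup>2 * (real b)\<^sup>2 + 4 * real a * real b"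
    unfolding s_def by simp
  then show ?thesis
    unfolding bfib_alpha_def s_def[symmetric] by (simp add: field_simps power2_eq_square)
qed

definition discrepancy :: "nat \<Rightarrow> nat \<Rightarrow> nat \<Rightarrow> real" where
  "discrepancy a b n = real b * real (count_list (bfib a b n) 0)
     - bfib_alpha a b * real (count_list (bfib a b n) 1)"

lemma discrepancy_rec:
  "discrepancy a b (Suc (Suc n)) =
     real (if even n then a else b) * discrepancy a b (Suc n) + discrepancy a b n"
  unfolding discrepancy_def by (simp add: count_list_word_power algebra_simps)

text \<open>
  The contraction factor \<open>\<beta>\<close> over two steps equals \<open>1 + a * b - \<alpha>\<close>: the discrepancies of the
  words of index 1 and 3 are \<open>b\<close> and \<open>b * (1 + a * b - \<alpha>)\<close>, and the quadratic equation of \<open>\<alpha>\<close> turns it into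
  \<open>1 / (1 + \<alpha>)\<close>. The even and the odd subsequence are both geometric with this factor.
\<close>

lemma discrepancy_closed_form:
  fixes a b k :: nat
  assumes "a \<ge> 1" and "b \<ge> 1"
  defines "\<beta> \<equiv> 1 / (1 + bfib_alpha a b)"
  shows "discrepancy a b (2 * k) = - bfib_alpha a b * \<beta> ^ k \<and>
         discrepancy a b (Suc (2 * k)) = real b * \<beta> ^ k"
proof (induction k)
  case 0
  show ?case by (simp add: discrepancy_def)
next
  case (Suc k)
  define \<alpha> where "\<alpha> = bfib_alpha a b"
  have pos: "\<alpha> > 0"
    unfolding \<alpha>_def using assms(1,2) by (rule bfib_alpha_pos)
  have "\<alpha>\<^sup>2 = real a * real b * (\<alpha> + 1)"
    unfolding \<alpha>_def by (rule bfib_alpha_square)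
  then have "(1 + real a * real b - \<alpha>) * (1 + \<alpha>) = 1"
    by (simp add: algebra_simps power2_eq_square)
  then have beta: "\<beta> = 1 + real a * real b - \<alpha>"
    using pos unfolding \<beta>_def \<alpha>_def[symmetric] by (simp add: field_simps)
  have contract: "\<alpha> * \<beta> = \<alpha> - real a * real b"
  proof -
    have "\<beta> * (1 + \<alpha>) = 1"
      using pos unfolding \<beta>_def \<alpha>_def[symmetric] by simp
    then have "\<beta> + \<alpha> * \<beta> = 1"
      by (simp add: algebra_simps)
    then show ?thesis using beta by linarith
  qed
  have IH: "discrepancy a b (2 * k) = - \<alpha> * \<beta> ^ k"
    "discrepancy a b (Suc (2 * k)) = real b * \<beta> ^ k"
    using Suc.IH unfolding \<alpha>_def by auto
  have even_step: "discrepancy a b (Suc (Suc (2 * k))) = - \<alpha> * \<beta> ^ Suc k"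
  proof -
    have "discrepancy a b (Suc (Suc (2 * k))) = - (\<alpha> - real a * real b) * \<beta> ^ k"
      unfolding discrepancy_rec[of a b "2 * k"] IH by (simp add: algebra_simps)
    also have "\<dots> = - \<alpha> * \<beta> ^ Suc k"
      unfolding contract[symmetric] by simp
    finally show ?thesis .
  qed
  have odd_step: "discrepancy a b (Suc (Suc (Suc (2 * k)))) = real b * \<beta> ^ Suc k"
  proof -
    have "discrepancy a b (Suc (Suc (Suc (2 * k)))) = real b * (1 - \<alpha> * \<beta>) * \<beta> ^ k"
      unfolding discrepancy_rec[of a b "Suc (2 * k)"] even_step IH by (simp add: algebra_simps)
    also have "1 - \<alpha> * \<beta> = \<beta>"
      using contract beta by simp
    finally show ?thesis by simp
  qed
  show ?case
    using even_step odd_step by (simp add: \<alpha>_def)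
qed

lemma discrepancy_bounded:
  assumes "a \<ge> 1" and "b \<ge> 1"
  shows "\<bar>discrepancy a b n\<bar> \<le> bfib_alpha a b + real b"
proof -
  define \<beta> where "\<beta> = 1 / (1 + bfib_alpha a b)"
  have pos: "bfib_alpha a b > 0"
    using assms by (rule bfib_alpha_pos)
  have pow: "0 \<le> \<beta> ^ k" "\<beta> ^ k \<le> 1" for k
    using pos by (auto simp: \<beta>_def power_le_one)
  note closed = discrepancy_closed_form[OF assms, folded \<beta>_def]
  show ?thesis
  proof (cases "even n")
    case True
    then obtain k where "n = 2 * k" by (elim evenE)
    then have "\<bar>discrepancy a b n\<bar> = bfib_alpha a b * \<beta> ^ k"
      using closed[of k] pos pow[of k] by (simp add: abs_mult)
    also have "\<dots> \<le> bfib_alpha a b"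
      using pos pow[of k] by (simp add: mult_left_le)
    finally show ?thesis by simp
  next
    case False
    then obtain k where "n = Suc (2 * k)" by (auto elim: oddE)
    then have "\<bar>discrepancy a b n\<bar> = real b * \<beta> ^ k"
      using closed[of k] pow[of k] by (simp add: abs_mult)
    also have "\<dots> \<le> real b"
      using pow[of k] by (simp add: mult_left_le)
    finally show ?thesis using pos by simp
  qed
qed

lemma discrepancy_over_length_tendsto_0:
  assumes "a \<ge> 1" and "b \<ge> 1"
  shows "(\<lambda>n. discrepancy a b n / real (length (bfib a b n))) \<longlonglongrightarrow> 0"
proof (rule tendsto_0_le[where K = "bfib_alpha a b + real b"])
  show "(\<lambda>n. 1 / real n) \<longlonglongrightarrow> 0"
    by (rule lim_1_over_n)
  show "\<forall>\<^sub>F n in sequentially.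
      norm (discrepancy a b n / real (length (bfib a b n)))
        \<le> norm (1 / real n) * (bfib_alpha a b + real b)"
    using eventually_gt_at_top[of 0]
  proof eventually_elim
    case (elim n)
    have "\<bar>discrepancy a b n\<bar> / real (length (bfib a b n)) \<le> (bfib_alpha a b + real b) / real n"
      using discrepancy_bounded[OF assms, of n] length_bfib_ge[OF assms, of n] elim
        bfib_alpha_pos[OF assms]
      by (intro frac_le) auto
    then show ?case by simp
  qed
qed

lemma bfib_ratio_tendsto:
  assumes "a \<ge> 1" and "b \<ge> 1"
  shows "bfib_ratio a b 1 \<longlonglongrightarrow> real b / (bfib_alpha a b + real b)"
    and "bfib_ratio a b 0 \<longlonglongrightarrow> bfib_alpha a b / (bfib_alpha a b + real b)"
proof -
  define \<alpha> where "\<alpha> = bfib_alpha a b"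
  define d where "d n = discrepancy a b n / real (length (bfib a b n))" for n
  have sum_pos: "\<alpha> + real b > 0"
    unfolding \<alpha>_def using bfib_alpha_pos[OF assms] by simp
  have d0: "d \<longlonglongrightarrow> 0"
    using discrepancy_over_length_tendsto_0[OF assms] unfolding d_def .
  have system: "bfib_ratio a b 0 n + bfib_ratio a b 1 n = 1"
    "real b * bfib_ratio a b 0 n - \<alpha> * bfib_ratio a b 1 n = d n" if "n > 0" for n
  proof -
    have "real (length (bfib a b n)) > 0"
      using length_bfib_ge[OF assms, of n] that by linarith
    then show "bfib_ratio a b 0 n + bfib_ratio a b 1 n = 1"
      unfolding bfib_ratio_def add_divide_distrib[symmetric] of_nat_add[symmetric]
        length_bfib[symmetric] by simp
    show "real b * bfib_ratio a b 0 n - \<alpha> * bfib_ratio a b 1 n = d n"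
      by (simp add: bfib_ratio_def d_def discrepancy_def \<alpha>_def diff_divide_distrib)
  qed
  have one: "bfib_ratio a b 1 n = (real b - d n) / (\<alpha> + real b)" if "n > 0" for n
  proof -
    have zero: "bfib_ratio a b 0 n = 1 - bfib_ratio a b 1 n"
      using system(1)[OF that] by simp
    have "bfib_ratio a b 1 n * (\<alpha> + real b) = real b - d n"
      using system(2)[OF that] unfolding zero by (simp add: algebra_simps)
    then show ?thesis
      using sum_pos by (simp add: eq_divide_eq)
  qed
  have "(\<lambda>n. (real b - d n) / (\<alpha> + real b)) \<longlonglongrightarrow> (real b - 0) / (\<alpha> + real b)"
    using sum_pos by (intro tendsto_intros d0) auto
  then have "(\<lambda>n. (real b - d n) / (\<alpha> + real b)) \<longlonglongrightarrow> real b / (\<alpha> + real b)"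
    by simp
  moreover have "\<forall>\<^sub>F n in sequentially. (real b - d n) / (\<alpha> + real b) = bfib_ratio a b 1 n"
    using eventually_gt_at_top[of 0] by eventually_elim (rule one[symmetric])
  ultimately have lim1: "bfib_ratio a b 1 \<longlonglongrightarrow> real b / (\<alpha> + real b)"
    by (rule Lim_transform_eventually)
  then show "bfib_ratio a b 1 \<longlonglongrightarrow> real b / (bfib_alpha a b + real b)"
    unfolding \<alpha>_def .
  have "(\<lambda>n. 1 - bfib_ratio a b 1 n) \<longlonglongrightarrow> 1 - real b / (\<alpha> + real b)"
    by (intro tendsto_intros lim1)
  also have "1 - real b / (\<alpha> + real b) = \<alpha> / (\<alpha> + real b)"
    using sum_pos by (simp add: field_simps)
  finally have "(\<lambda>n. 1 - bfib_ratio a b 1 n) \<longlonglongrightarrow> \<alpha> / (\<alpha> + real b)" .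
  moreover have "\<forall>\<^sub>F n in sequentially. 1 - bfib_ratio a b 1 n = bfib_ratio a b 0 n"
    using eventually_gt_at_top[of 0]
  proof eventually_elim
    case (elim n)
    then show ?case using system(1)[of n] by simp
  qed
  ultimately show "bfib_ratio a b 0 \<longlonglongrightarrow> bfib_alpha a b / (bfib_alpha a b + real b)"
    unfolding \<alpha>_def by (rule Lim_transform_eventually)
qed

theorem theorem4p3:
  fixes a b :: nat
  assumes "a \<ge> 1" and "b \<ge> 1"
  shows "convergent (bfib_ratio a b 1) \<and>
         bfib_freq a b 1 = real b / (bfib_alpha a b + real b) \<and>
         convergent (bfib_ratio a b 0) \<and>
         bfib_freq a b 0 = bfib_alpha a b / (bfib_alpha a b + real b)"
  using bfib_ratio_tendsto[OF assms] unfolding bfib_freq_def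
  by (auto intro: convergentI limI)

end
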